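(* Let $(X,\mathcal{A},\mu)$ be a complete $\sigma$-finite measure space, let $S$ be the space of simple functions $X\to\mathbb{R}$ and $\varphi:S\to\mathbb{R}$ the integral on simple functions. Let $\overline{S}=S_{VL}$ $(=S_{LV})$ and $\overline{\varphi}=\varphi_{VL}$ $(=\varphi_{LV})$ be the combined vertical and lateral extensions of $S$ and $\varphi$. Then $\overline{S}=\mathcal{L}^1(\mu)$ and $\overline{\varphi}(f)=\int f\,d\mu$ for all $f\in\overline{S}$.
   Context: $\mathcal{L}^1(\mu)$ is the space of ($\mu$-)integrable functions $X\to\mathbb{R}$ (functions, not equivalence classes). $\mathbb{R}^X$ carries the pointwise order; $\Delta^+=\{f\in\Delta: f\ge 0\}$; $\mathbb{1}_A$ is the indicator function of $A$. Let $\mathcal{I}=\{A\in\mathcal{A}:\mu(A)<\infty\}$. A partition is a disjoint sequence $(A_n)_{n\in\mathbb{N}}$ in $\mathcal{I}$ with union $X$. A simple function is one of the form $f=\sum_{n=1}^N a_n\mathbb{1}_{A_n}$ with $a_n\in\mathbb{R}$, $A_n\in\mathcal{I}$, and $\varphi(f)=\sum_{n=1}^N\mu(A_n)a_n$. Let $\Delta\subset\mathbb{R}^X$ be a linear subspace and $\omega:\Delta\to\mathbb{R}$ linear and order preserving. Vertical extension: $\Delta_V$ is the set of $f\in\mathbb{R}^X$ for which there are nonempty countable $\Lambda,\Upsilon\subset\Delta$ with $\sigma\le f\le\tau$ for all $\sigma\in\Lambda,\tau\in\Upsilon$ and $\sup\omega(\Lambda)=\inf\omega(\Upsilon)$ (both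 existing in $\mathbb R$); $\omega_V(f)$ is this common value (independent of choices). $\Delta$ is directed if $\Delta=\Delta^+-\Delta^+$, and stable if $f\mathbb{1}_A\in\Delta$ for all $f\in\Delta$, $A\in\mathcal{I}$. For stable $\Delta$, $\omega$ is laterally extendable if $\omega(f)=\sup_N\sum_{n=1}^N\omega(f\mathbb{1}_{A_n})$ for all $f\in\Delta^+$ and all partitions $(A_n)$. Lateral extension (for $\Delta$ directed and stable, $\omega$ laterally extendable): $(\Delta^+)_L$ is the set of $f:X\to[0,\infty)$ for which there is a partition $(A_n)$ with $f\mathbb{1}_{A_n}\in\Delta$ for all $n$ and $\sum_n\omega(f\mathbb{1}_{A_n})<\infty$; then $\omega_L(f)$ is this sum (independent of the partition). $\Delta_L=\{f_1-f_2:f_1,f_2\in(\Delta^+)_L\}$ and $\omega_L(f_1-f_2)=\omega_L(f_1)-\omega_L(f_2)$. $S_{VL}=(S_V)_L$, $S_{LV}=(S_L)_V$, and similarly for $\varphi$. The space $S_V$ is directed and stable and $\varphi_V$ is laterally extendable, so $S_{VL}$ is defined; moreover $S_{LV}=S_{VL}$ and $\varphi_{LV}=\varphi_{VL}$. *)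

theory Defs
  imports "HOL-Analysis.Analysis"
begin

text \<open>
  The space of real functions on \<open>X\<close>.  A function \<open>X \<rightarrow> \<real>\<close> is represented by its extension by zero
  to the whole type, so that each function on \<open>X\<close> has exactly one representative and the pointwise
  order and operations on the type \<open>'a \<Rightarrow> real\<close> are those of the functions on \<open>X\<close>.
\<close>

definition fun_on :: "'a set \<Rightarrow> ('a \<Rightarrow> real) set" where
  "fun_on X = {f. \<forall>x. x \<notin> X \<longrightarrow> f x = 0}"

definition fin_sets :: "'a measure \<Rightarrow> 'a set set" where
  "fin_sets M = {A \<in> sets M. emeasure M A < \<infinity>}"

definition is_partition :: "'a measure \<Rightarrow> (nat \<Rightarrow> 'a set) \<Rightarrow> bool" where
  "is_partition M A \<longleftrightarrow>
     (\<forall>n. A n \<in> fin_sets M) \<and> disjoint_family A \<and> (\<Union>n. A n) = space M"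

definition simple_repr ::
    "'a measure \<Rightarrow> ('a \<Rightarrow> real) \<Rightarrow> nat \<Rightarrow> (nat \<Rightarrow> real) \<Rightarrow> (nat \<Rightarrow> 'a set) \<Rightarrow> bool" where
  "simple_repr M f N a A \<longleftrightarrow>
     (\<forall>n\<in>{1..N}. A n \<in> fin_sets M) \<and> f = (\<lambda>x. \<Sum>n=1..N. a n * indicat_real (A n) x)"

definition simple_funs :: "'a measure \<Rightarrow> ('a \<Rightarrow> real) set" where
  "simple_funs M = {f. \<exists>N a A. simple_repr M f N a A}"

definition simple_int :: "'a measure \<Rightarrow> ('a \<Rightarrow> real) \<Rightarrow> real" where
  "simple_int M f =
     (THE c. \<exists>N a A. simple_repr M f N a A \<and> c = (\<Sum>n=1..N. measure M (A n) * a n))"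

text \<open>
  In the following, \<open>D\<close> is a space of functions on \<open>X\<close> or on \<open>space M\<close>, and \<open>w\<close> is a functional of
  which only the values on \<open>D\<close> matter.  The extensions are written down for arbitrary \<open>D\<close> and \<open>w\<close>;
  they are meaningful under the usual conditions (\<open>w\<close> linear and order preserving on the linear
  space \<open>D\<close>; for the lateral extension moreover \<open>D\<close> directed and stable and \<open>w\<close> laterally
  extendable), under which the values below do not depend on the choices made.
\<close>

definition vert_witness ::
    "('a \<Rightarrow> real) set \<Rightarrow> (('a \<Rightarrow> real) \<Rightarrow> real) \<Rightarrow> ('a \<Rightarrow> real)
      \<Rightarrow> ('a \<Rightarrow> real) set \<Rightarrow> ('a \<Rightarrow> real) set \<Rightarrow> bool" where
  "vert_witness D w f \<Lambda> \<Upsilon> \<longleftrightarrow>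
     \<Lambda> \<noteq> {} \<and> countable \<Lambda> \<and> \<Lambda> \<subseteq> D \<and>
     \<Upsilon> \<noteq> {} \<and> countable \<Upsilon> \<and> \<Upsilon> \<subseteq> D \<and>
     (\<forall>\<sigma>\<in>\<Lambda>. \<forall>\<tau>\<in>\<Upsilon>. \<sigma> \<le> f \<and> f \<le> \<tau>) \<and>
     bdd_above (w ` \<Lambda>) \<and> bdd_below (w ` \<Upsilon>) \<and> Sup (w ` \<Lambda>) = Inf (w ` \<Upsilon>)"

definition vert_space ::
    "'a set \<Rightarrow> ('a \<Rightarrow> real) set \<Rightarrow> (('a \<Rightarrow> real) \<Rightarrow> real) \<Rightarrow> ('a \<Rightarrow> real) set" where
  "vert_space X D w = {f \<in> fun_on X. \<exists>\<Lambda> \<Upsilon>. vert_witness D w f \<Lambda> \<Upsilon>}"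

definition vert_val ::
    "('a \<Rightarrow> real) set \<Rightarrow> (('a \<Rightarrow> real) \<Rightarrow> real) \<Rightarrow> ('a \<Rightarrow> real) \<Rightarrow> real" where
  "vert_val D w f = (THE c. \<exists>\<Lambda> \<Upsilon>. vert_witness D w f \<Lambda> \<Upsilon> \<and> c = Sup (w ` \<Lambda>))"

text \<open>
  The lateral extension.  On the positive cone of \<open>D\<close> the functional \<open>w\<close> is nonnegative, so finiteness
  of the sum over a partition is summability.
\<close>

definition lat_witness ::
    "'a measure \<Rightarrow> ('a \<Rightarrow> real) set \<Rightarrow> (('a \<Rightarrow> real) \<Rightarrow> real) \<Rightarrow> ('a \<Rightarrow> real)
      \<Rightarrow> (nat \<Rightarrow> 'a set) \<Rightarrow> bool" where
  "lat_witness M D w f A \<longleftrightarrow>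
     is_partition M A \<and> (\<forall>n. (\<lambda>x. f x * indicat_real (A n) x) \<in> D) \<and>
     summable (\<lambda>n. w (\<lambda>x. f x * indicat_real (A n) x))"

definition lat_pos_space ::
    "'a measure \<Rightarrow> ('a \<Rightarrow> real) set \<Rightarrow> (('a \<Rightarrow> real) \<Rightarrow> real) \<Rightarrow> ('a \<Rightarrow> real) set" where
  "lat_pos_space M D w =
     {f \<in> fun_on (space M). (\<forall>x. 0 \<le> f x) \<and> (\<exists>A. lat_witness M D w f A)}"

definition lat_pos_val ::
    "'a measure \<Rightarrow> ('a \<Rightarrow> real) set \<Rightarrow> (('a \<Rightarrow> real) \<Rightarrow> real) \<Rightarrow> ('a \<Rightarrow> real) \<Rightarrow> real" where
  "lat_pos_val M D w f =
     (THE s. \<exists>A. lat_witness M D w f A \<and> s = (\<Sum>n. w (\<lambda>x. f x * indicat_real (A n) x)))"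

definition lat_space ::
    "'a measure \<Rightarrow> ('a \<Rightarrow> real) set \<Rightarrow> (('a \<Rightarrow> real) \<Rightarrow> real) \<Rightarrow> ('a \<Rightarrow> real) set" where
  "lat_space M D w =
     {(\<lambda>x. f1 x - f2 x) | f1 f2. f1 \<in> lat_pos_space M D w \<and> f2 \<in> lat_pos_space M D w}"

definition lat_val ::
    "'a measure \<Rightarrow> ('a \<Rightarrow> real) set \<Rightarrow> (('a \<Rightarrow> real) \<Rightarrow> real) \<Rightarrow> ('a \<Rightarrow> real) \<Rightarrow> real" where
  "lat_val M D w f =
     (THE c. \<exists>f1 f2. f1 \<in> lat_pos_space M D w \<and> f2 \<in> lat_pos_space M D w \<and>
        f = (\<lambda>x. f1 x - f2 x) \<and> c = lat_pos_val M D w f1 - lat_pos_val M D w f2)"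

definition S_V :: "'a measure \<Rightarrow> ('a \<Rightarrow> real) set" where
  "S_V M = vert_space (space M) (simple_funs M) (simple_int M)"

definition phi_V :: "'a measure \<Rightarrow> ('a \<Rightarrow> real) \<Rightarrow> real" where
  "phi_V M = vert_val (simple_funs M) (simple_int M)"

definition S_L :: "'a measure \<Rightarrow> ('a \<Rightarrow> real) set" where
  "S_L M = lat_space M (simple_funs M) (simple_int M)"

definition phi_L :: "'a measure \<Rightarrow> ('a \<Rightarrow> real) \<Rightarrow> real" where
  "phi_L M = lat_val M (simple_funs M) (simple_int M)"

definition S_VL :: "'a measure \<Rightarrow> ('a \<Rightarrow> real) set" where
  "S_VL M = lat_space M (S_V M) (phi_V M)"

definition phi_VL :: "'a measure \<Rightarrow> ('a \<Rightarrow> real) \<Rightarrow> real" where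
  "phi_VL M = lat_val M (S_V M) (phi_V M)"

definition S_LV :: "'a measure \<Rightarrow> ('a \<Rightarrow> real) set" where
  "S_LV M = vert_space (space M) (S_L M) (phi_L M)"

definition phi_LV :: "'a measure \<Rightarrow> ('a \<Rightarrow> real) \<Rightarrow> real" where
  "phi_LV M = vert_val (S_L M) (phi_L M)"

definition L1_funs :: "'a measure \<Rightarrow> ('a \<Rightarrow> real) set" where
  "L1_funs M = {f \<in> fun_on (space M). integrable M f}"

end

theory Submission imports Defs begin

text \<open>
  The two inclusions between \<open>\<L>\<^sup>1(\<mu>)\<close> and the extended spaces have different reasons.

  No extension leaves \<open>\<L>\<^sup>1(\<mu>)\<close>, and the extended functional is always the integral.  This property
  of a pair \<open>(D, w)\<close> (\<open>integral_on\<close>) holds for simple functions and is inherited by both kinds of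
  extension, in whatever order they are applied.  For the lateral extension the reason is monotone
  convergence (\<open>integral_on_lat\<close>).  For the vertical extension it is completeness of the measure: a
  function between \<open>\<Lambda>\<close> and \<open>\<Upsilon>\<close> lies between the pointwise supremum of \<open>\<Lambda>\<close> and the pointwise infimum
  of \<open>\<Upsilon>\<close>, which are measurable because the families are countable, and which agree almost everywhere
  because their integrals are squeezed to the same value (\<open>integral_on_vert\<close>).  The agreement of the
  values with the integral also shows that they do not depend on any choices.

  Conversely, an integrable function is reached in either order by bracketing it on a grid.  Let
  \<open>p \<ge> 0\<close> be integrable and positive wherever \<open>f\<close> is nonzero.  Rounding \<open>f\<close> down to a multiple of
  \<open>p / m\<close> gives a lower bound of \<open>f\<close>, and adding \<open>p / m\<close> gives an upper bound; the gap has integral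
  \<open>(\<integral>p) / m\<close>, which tends to zero (\<open>vert_space_gridI\<close>).

  \<^item> Taking for \<open>p\<close> the indicator of a set of finite measure, the bounds are simple if \<open>f\<close> is bounded
    and vanishes off that set, so such \<open>f\<close> lie in \<open>S_V\<close>.  A nonnegative integrable function has this
    form on each piece of a partition adapted to its level sets \<open>k \<le> f < k + 1\<close>, so it lies in \<open>S_VL\<close>.
  \<^item> Taking for \<open>p\<close> a positive integrable function with countably many values, which exists by
    sigma-finiteness, the bounds have countably many values.  They are constant on the pieces of a
    partition adapted to these values, so they lie in \<open>S_L\<close> and \<open>f\<close> lies in \<open>S_LV\<close>.
\<close>

section \<open>Functionals that agree with the integral\<close>

definition integral_on :: "'a measure \<Rightarrow> ('a \<Rightarrow> real) set \<Rightarrow> (('a \<Rightarrow> real) \<Rightarrow> real) \<Rightarrow> bool" where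
  "integral_on M D w \<longleftrightarrow> D \<subseteq> L1_funs M \<and> (\<forall>f\<in>D. w f = (LINT x|M. f x))"

lemma integral_onD:
  assumes "integral_on M D w" "f \<in> D"
  shows "integrable M f" "f \<in> fun_on (space M)" "w f = (LINT x|M. f x)"
  using assms by (auto simp: integral_on_def L1_funs_def)

lemma fin_setsD:
  assumes "A \<in> fin_sets M"
  shows "A \<in> sets M" "emeasure M A < \<infinity>" "A \<subseteq> space M"
  using assms sets.sets_into_space by (auto simp: fin_sets_def)

lemma simple_repr_integral:
  assumes "simple_repr M f N a A"
  shows "f \<in> L1_funs M" "(LINT x|M. f x) = (\<Sum>n=1..N. measure M (A n) * a n)"
proof -
  have A: "A n \<in> sets M" "emeasure M (A n) < \<infinity>" "A n \<subseteq> space M" if "n \<in> {1..N}" for n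
    using fin_setsD[of "A n" M] assms that by (simp_all add: simple_repr_def)
  have f: "f = (\<lambda>x. \<Sum>n=1..N. a n * indicat_real (A n) x)"
    using assms by (simp add: simple_repr_def)
  have int: "integrable M (\<lambda>x. a n * indicat_real (A n) x)" if "n \<in> {1..N}" for n
    using A[OF that] by (intro integrable_mult_right integrable_real_indicator)
  have "f x = 0" if "x \<notin> space M" for x
    unfolding f using A(3) that by (intro sum.neutral) (fastforce simp: indicator_def)
  moreover have "integrable M f"
    unfolding f using int by (intro Bochner_Integration.integrable_sum)
  ultimately show "f \<in> L1_funs M"
    by (simp add: L1_funs_def fun_on_def)
  have "(LINT x|M. f x) = (\<Sum>n=1..N. LINT x|M. a n * indicat_real (A n) x)"
    unfolding f using int by (rule Bochner_Integration.integral_sum)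
  also have "\<dots> = (\<Sum>n=1..N. measure M (A n) * a n)"
    using A(3) by (intro sum.cong) (simp_all add: Int_absorb2)
  finally show "(LINT x|M. f x) = (\<Sum>n=1..N. measure M (A n) * a n)" .
qed

lemma integral_on_simple: "integral_on M (simple_funs M) (simple_int M)"
proof -
  have "simple_int M f = (LINT x|M. f x)" if "f \<in> simple_funs M" for f
    unfolding simple_int_def
    using that simple_repr_integral(2)[of M f]
    by (intro the_equality) (force simp: simple_funs_def)+
  then show ?thesis
    using simple_repr_integral(1) by (auto simp: integral_on_def simple_funs_def)
qed

section \<open>Vertical extension stays within the integrable functions\<close>

text \<open>
  Only the supremum and infimum of the numbers \<open>w s\<close> are known to agree; the families need not be
  directed, so the pointwise envelopes \<open>g = sup \<Lambda>\<close> and \<open>h = inf \<Upsilon>\<close> need not be limits of members.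
  Still \<open>Sup (w ` \<Lambda>) \<le> \<integral>g \<le> \<integral>h \<le> Inf (w ` \<Upsilon>)\<close>, and equality of the ends gives \<open>g = f = h\<close> almost
  everywhere.
\<close>

lemma vert_witness_integral:
  assumes "complete_measure M" and D: "integral_on M D w"
    and f: "f \<in> fun_on (space M)" and wit: "vert_witness D w f \<Lambda> \<Upsilon>"
  shows "f \<in> L1_funs M" "Sup (w ` \<Lambda>) = (LINT x|M. f x)"
proof -
  interpret complete_measure M by fact
  note W = wit[unfolded vert_witness_def]
  obtain \<sigma>0 \<tau>0 where st0: "\<sigma>0 \<in> \<Lambda>" "\<tau>0 \<in> \<Upsilon>"
    using W by blast
  have int: "integrable M s" "w s = (LINT x|M. s x)" if "s \<in> \<Lambda> \<union> \<Upsilon>" for s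
    using integral_onD[OF D, of s] that W by auto
  have le: "s x \<le> f x" "f x \<le> t x" if "s \<in> \<Lambda>" "t \<in> \<Upsilon>" for s t x
    using W that by (auto simp: le_fun_def)
  define g where "g x = (SUP s\<in>\<Lambda>. s x)" for x
  define h where "h x = (INF t\<in>\<Upsilon>. t x)" for x
  have bdd: "bdd_above ((\<lambda>s. s x) ` \<Lambda>)" "bdd_below ((\<lambda>t. t x) ` \<Upsilon>)" for x
    using le st0 by (auto intro!: bdd_aboveI2 bdd_belowI2)
  have sg: "s x \<le> g x" if "s \<in> \<Lambda>" for s x
    unfolding g_def using bdd that by (intro cSUP_upper)
  have ht: "h x \<le> t x" if "t \<in> \<Upsilon>" for t x
    unfolding h_def using bdd that by (intro cINF_lower)
  have gf: "g x \<le> f x" for x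
    unfolding g_def using st0 le by (intro cSUP_least) auto
  have fh: "f x \<le> h x" for x
    unfolding h_def using st0 le by (intro cINF_greatest) auto
  have gm[measurable]: "g \<in> borel_measurable M"
    unfolding g_def using W int bdd by (intro borel_measurable_cSUP) auto
  have hm[measurable]: "h \<in> borel_measurable M"
    unfolding h_def using W int bdd by (intro borel_measurable_cINF) auto
  have between: "integrable M u" if "u \<in> borel_measurable M" "\<And>x. \<sigma>0 x \<le> u x" "\<And>x. u x \<le> \<tau>0 x" for u
  proof (rule Bochner_Integration.integrable_bound)
    show "integrable M (\<lambda>x. \<bar>\<sigma>0 x\<bar> + \<bar>\<tau>0 x\<bar>)"
      using int st0 by auto
    have "\<bar>u x\<bar> \<le> \<bar>\<sigma>0 x\<bar> + \<bar>\<tau>0 x\<bar>" for x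
      using that(2,3)[of x] by linarith
    then show "AE x in M. norm (u x) \<le> norm (\<bar>\<sigma>0 x\<bar> + \<bar>\<tau>0 x\<bar>)"
      by simp
  qed fact
  have gh_le: "g x \<le> h x" for x
    using gf fh by (rule order_trans)
  have gi: "integrable M g"
    using gm sg[OF st0(1)] order_trans[OF gh_le ht[OF st0(2)]] by (rule between)
  have hi: "integrable M h"
    using hm order_trans[OF sg[OF st0(1)] gh_le] ht[OF st0(2)] by (rule between)
  have "Sup (w ` \<Lambda>) \<le> (LINT x|M. g x)"
    using st0 int sg gi by (intro cSUP_least) (auto intro!: integral_mono)
  moreover have "(LINT x|M. h x) \<le> Inf (w ` \<Upsilon>)"
    using st0 int ht hi by (intro cINF_greatest) (auto intro!: integral_mono)
  moreover have gh: "(LINT x|M. g x) \<le> (LINT x|M. h x)"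
    using gi hi gh_le by (rule integral_mono)
  ultimately have eq: "(LINT x|M. g x) = Sup (w ` \<Lambda>)" "(LINT x|M. h x) = (LINT x|M. g x)"
    using W by auto
  have "(LINT x|M. h x - g x) = 0"
    using gi hi eq by simp
  then have "AE x in M. h x - g x = 0"
    using gi hi gh_le by (subst (asm) integral_nonneg_eq_0_iff_AE) auto
  then have gfAE: "AE x in M. g x = f x"
  proof eventually_elim
    fix x assume "h x - g x = 0"
    then show "g x = f x" using gf[of x] fh[of x] by linarith
  qed
  \<comment> \<open>Completeness turns almost everywhere agreement with \<open>g\<close> into measurability.\<close>
  have fm: "f \<in> borel_measurable M"
  proof (rule measurableI)
    fix B :: "real set" assume B: "B \<in> sets borel"
    show "f -` B \<inter> space M \<in> sets M"
    proof (rule in_sets_AE)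
      show "g -` B \<inter> space M \<in> sets M"
        using gm B by (rule measurable_sets)
      show "AE x in M. x \<in> g -` B \<inter> space M \<longleftrightarrow> x \<in> f -` B \<inter> space M"
        using gfAE by eventually_elim auto
    qed auto
  qed simp
  have "integrable M f"
    using gi fm gfAE by (rule integrable_cong_AE_imp)
  then show "f \<in> L1_funs M"
    using f by (simp add: L1_funs_def)
  have "(LINT x|M. g x) = (LINT x|M. f x)"
    using gm fm gfAE by (rule integral_cong_AE)
  then show "Sup (w ` \<Lambda>) = (LINT x|M. f x)"
    using eq by simp
qed

lemma integral_on_vert:
  assumes "complete_measure M" "integral_on M D w"
  shows "integral_on M (vert_space (space M) D w) (vert_val D w)"
proof -
  note int = vert_witness_integral[OF assms]
  have "vert_val D w f = (LINT x|M. f x)" if f: "f \<in> vert_space (space M) D w" for f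
  proof -
    obtain \<Lambda> \<Upsilon> where "f \<in> fun_on (space M)" "vert_witness D w f \<Lambda> \<Upsilon>"
      using f by (auto simp: vert_space_def)
    then show ?thesis
      unfolding vert_val_def using int(2)
      by (intro the_equality) (metis, metis)
  qed
  then show ?thesis
    using int(1) by (auto simp: integral_on_def vert_space_def)
qed

section \<open>Lateral extension stays within the integrable functions\<close>

lemma partition_sums:
  assumes "is_partition M A" "f \<in> fun_on (space M)"
  shows "(\<lambda>n. f x * indicat_real (A n) x) sums f x"
proof (cases "x \<in> space M")
  case True
  then obtain k where k: "x \<in> A k"
    using assms by (auto simp: is_partition_def)
  have "x \<in> A n \<longleftrightarrow> n = k" for n
    using assms k by (auto simp: is_partition_def disjoint_family_on_def)
  then have "(\<lambda>n. f x * indicat_real (A n) x) = (\<lambda>n. if n = k then f x else 0)"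
    by (auto simp: indicator_def)
  then show ?thesis
    using sums_single[of k "\<lambda>_. f x"] by simp
next
  case False
  then show ?thesis
    using assms by (simp add: fun_on_def)
qed

text \<open>
  The pieces \<open>f \<cdot> 1\<^bsub>A n\<^esub>\<close> are nonnegative, so summability of their integrals suffices to
  integrate the series \<open>f = (\<Sum>n. f \<cdot> 1\<^bsub>A n\<^esub>)\<close> term by term.
\<close>

lemma lat_witness_integral:
  assumes D: "integral_on M D w"
    and f: "f \<in> fun_on (space M)" "\<And>x. 0 \<le> f x" and wit: "lat_witness M D w f A"
  shows "f \<in> L1_funs M" "(\<Sum>n. w (\<lambda>x. f x * indicat_real (A n) x)) = (LINT x|M. f x)"
proof -
  let ?f = "\<lambda>n x. f x * indicat_real (A n) x"
  have P: "is_partition M A" and fD: "\<And>n. ?f n \<in> D" and sm: "summable (\<lambda>n. w (?f n))"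
    using wit by (auto simp: lat_witness_def)
  have int: "integrable M (?f n)" "w (?f n) = (LINT x|M. ?f n x)" for n
    using integral_onD[OF D fD] by auto
  have fs: "(\<lambda>n. ?f n x) sums f x" for x
    using partition_sums[OF P f(1)] .
  have norm: "norm (?f n x) = ?f n x" for n x
    using f(2) by simp
  have "AE x in M. summable (\<lambda>n. norm (?f n x))" "summable (\<lambda>n. LINT x|M. norm (?f n x))"
    unfolding norm using fs sm int(2) by (auto simp: sums_iff)
  note R = integrable_suminf[OF int(1) this] integral_suminf[OF int(1) this]
  have eq: "(\<lambda>x. \<Sum>n. ?f n x) = f"
    using fs by (auto simp: sums_iff)
  show "f \<in> L1_funs M"
    using R(1) f(1) unfolding eq by (simp add: L1_funs_def)
  show "(\<Sum>n. w (?f n)) = (LINT x|M. f x)"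
    using R(2) unfolding eq int(2) by simp
qed

lemma lat_pos_integral:
  assumes D: "integral_on M D w" and f: "f \<in> lat_pos_space M D w"
  shows "f \<in> L1_funs M" "lat_pos_val M D w f = (LINT x|M. f x)"
proof -
  obtain A where A: "f \<in> fun_on (space M)" "\<And>x. 0 \<le> f x" "lat_witness M D w f A"
    using f by (auto simp: lat_pos_space_def)
  note int = lat_witness_integral[OF D A(1,2)]
  show "f \<in> L1_funs M"
    using int(1) A(3) .
  show "lat_pos_val M D w f = (LINT x|M. f x)"
    unfolding lat_pos_val_def using int(2) A(3)
    by (intro the_equality) (metis, metis)
qed

lemma integral_on_lat:
  assumes D: "integral_on M D w"
  shows "integral_on M (lat_space M D w) (lat_val M D w)"
proof -
  note pos = lat_pos_integral[OF D]
  have diff: "(\<lambda>x. f1 x - f2 x) \<in> L1_funs M \<and>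
      lat_pos_val M D w f1 - lat_pos_val M D w f2 = (LINT x|M. f1 x - f2 x)"
    if "f1 \<in> lat_pos_space M D w" "f2 \<in> lat_pos_space M D w" for f1 f2
    using pos[OF that(1)] pos[OF that(2)] by (auto simp: L1_funs_def fun_on_def)
  have "lat_val M D w f = (LINT x|M. f x)" if f: "f \<in> lat_space M D w" for f
    unfolding lat_val_def using f diff
    by (intro the_equality) (fastforce simp: lat_space_def)+
  then show ?thesis
    using diff by (auto simp: integral_on_def lat_space_def)
qed

section \<open>Membership in the extended spaces\<close>

text \<open>
  The canonical representation: sum over the values of \<open>u\<close>, each on its level set.  Intersecting with
  \<open>A\<close> makes all these sets finite in measure, including the level set of the value zero.
\<close>

lemma simple_funsI:
  assumes meas: "u \<in> borel_measurable M" and fin: "finite (range u)"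
    and A: "A \<in> fin_sets M" and off: "\<And>x. x \<notin> A \<Longrightarrow> u x = 0"
  shows "u \<in> simple_funs M"
proof -
  obtain a where a: "bij_betw a {1..card (range u)} (range u)"
    using ex_bij_betw_nat_finite_1[OF fin] by blast
  let ?N = "card (range u)" and ?A = "\<lambda>n. A \<inter> u -` {a n}"
  have "?A n \<in> fin_sets M" for n
  proof -
    have "?A n = A \<inter> (u -` {a n} \<inter> space M)"
      using fin_setsD(3)[OF A] by auto
    then have "?A n \<in> sets M"
      using meas fin_setsD(1)[OF A] by (auto intro!: sets.Int intro: measurable_sets)
    moreover have "emeasure M (?A n) \<le> emeasure M A"
      using fin_setsD(1)[OF A] by (intro emeasure_mono) auto
    ultimately show ?thesis
      using fin_setsD(2)[OF A] by (auto simp: fin_sets_def)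
  qed
  moreover have "u x = (\<Sum>n=1..?N. a n * indicat_real (?A n) x)" for x
  proof -
    have "(\<Sum>n=1..?N. a n * indicat_real (?A n) x) =
        (\<Sum>v\<in>range u. v * indicat_real (A \<inter> u -` {v}) x)"
      by (rule sum.reindex_bij_betw[OF a])
    also have "\<dots> = (\<Sum>v\<in>range u. if v = u x then u x else 0)"
      using off by (intro sum.cong) (auto simp: indicator_def)
    also have "\<dots> = u x"
      using fin by simp
    finally show ?thesis by simp
  qed
  ultimately have "simple_repr M u ?N a ?A"
    by (auto simp: simple_repr_def)
  then show ?thesis
    by (auto simp: simple_funs_def)
qed

text \<open>
  The partition is built from a countable labelling \<open>l\<close> of the points: a sigma-finite partition is
  refined by the level sets of \<open>l\<close>, and the pairs (piece, label) are enumerated as natural numbers.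
  This way \<open>f\<close> only has to be understood on sets of finite measure with a constant label.
\<close>

lemma lat_pos_spaceI:
  assumes "sigma_finite_measure M" and D: "integral_on M D w"
    and f: "f \<in> L1_funs M" "\<And>x. 0 \<le> f x"
    and lab: "\<And>k::nat. {x \<in> space M. l x = k} \<in> sets M"
    and in_D: "\<And>A k. A \<in> fin_sets M \<Longrightarrow> (\<And>x. x \<in> A \<Longrightarrow> l x = k) \<Longrightarrow>
      (\<lambda>x. f x * indicat_real A x) \<in> D"
  shows "f \<in> lat_pos_space M D w"
proof -
  interpret sigma_finite_measure M by fact
  obtain B :: "nat \<Rightarrow> 'a set" where B: "range B \<subseteq> sets M" "(\<Union>i. B i) = space M"
      "\<And>i. emeasure M (B i) \<noteq> \<infinity>" "disjoint_family B"
    using sigma_finite_disjoint by blast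
  define A where "A i = B (fst (prod_decode i)) \<inter> {x \<in> space M. l x = snd (prod_decode i)}" for i
  have fin: "A i \<in> fin_sets M" for i
  proof -
    have "A i \<in> sets M"
      unfolding A_def using B(1) lab by (intro sets.Int) auto
    moreover have "emeasure M (A i) \<le> emeasure M (B (fst (prod_decode i)))"
      unfolding A_def using B(1) by (intro emeasure_mono) auto
    ultimately show ?thesis
      using B(3)[of "fst (prod_decode i)"] by (auto simp: fin_sets_def top.not_eq_extremum)
  qed
  have dis: "disjoint_family A"
    unfolding disjoint_family_on_def
  proof (intro ballI impI)
    fix i j :: nat assume "i \<noteq> j"
    then have "fst (prod_decode i) \<noteq> fst (prod_decode j) \<or> snd (prod_decode i) \<noteq> snd (prod_decode j)"
      by (metis prod.expand prod_decode_inverse)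
    then show "A i \<inter> A j = {}"
      using B(4) by (auto simp: A_def disjoint_family_on_def)
  qed
  have "x \<in> (\<Union>i. A i)" if x: "x \<in> space M" for x
  proof -
    obtain n where "x \<in> B n"
      using x B(2) by blast
    then have "x \<in> A (prod_encode (n, l x))"
      using x by (simp add: A_def)
    then show ?thesis by blast
  qed
  moreover have "A i \<subseteq> space M" for i
    by (auto simp: A_def)
  ultimately have P: "is_partition M A"
    using fin dis by (auto simp: is_partition_def)
  let ?f = "\<lambda>n x. f x * indicat_real (A n) x"
  have fD: "?f n \<in> D" for n
    by (rule in_D[OF fin, of n "snd (prod_decode n)"]) (simp add: A_def)
  have int: "integrable M (?f n)" "w (?f n) = (LINT x|M. ?f n x)" for n
    using integral_onD[OF D fD] by auto
  have "summable (\<lambda>n. LINT x|M. ?f n x)"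
  proof (rule summableI_nonneg_bounded)
    show "0 \<le> (LINT x|M. ?f n x)" for n
      using f(2) by (intro integral_nonneg_AE) simp
    show "(\<Sum>i<n. LINT x|M. ?f i x) \<le> (LINT x|M. f x)" for n
    proof -
      have "(\<Sum>i<n. LINT x|M. ?f i x) = (LINT x|M. (\<Sum>i<n. ?f i x))"
        using int by (intro Bochner_Integration.integral_sum[symmetric]) auto
      also have "\<dots> \<le> (LINT x|M. f x)"
      proof (rule integral_mono)
        show "integrable M (\<lambda>x. \<Sum>i<n. ?f i x)"
          using int by (intro Bochner_Integration.integrable_sum)
        show "integrable M f"
          using f by (simp add: L1_funs_def)
        show "(\<Sum>i<n. ?f i x) \<le> f x" for x
        proof -
          have "(\<lambda>i. ?f i x) sums f x"
            using partition_sums[OF P] f(1) by (simp add: L1_funs_def)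
          then show ?thesis
            using sum_le_suminf[of "\<lambda>i. ?f i x" "{..<n}"] f(2) by (auto simp: sums_iff)
        qed
      qed
      finally show ?thesis .
    qed
  qed
  then have "lat_witness M D w f A"
    unfolding lat_witness_def int(2) using P fD by blast
  then show ?thesis
    using f by (auto simp: lat_pos_space_def L1_funs_def)
qed

text \<open>
  Reduction to the positive parts of \<open>f\<close> and \<open>-f\<close>.  The premise on \<open>g\<close> keeps its formula in terms of
  \<open>f\<close>, through which properties such as a countable range pass from \<open>f\<close> to \<open>g\<close>.
\<close>

lemma L1_in_lat_spaceI:
  assumes f: "f \<in> L1_funs M"
    and pos: "\<And>s g. g = (\<lambda>x. max 0 (s * f x)) \<Longrightarrow> g \<in> L1_funs M \<Longrightarrow> (\<And>x. 0 \<le> g x) \<Longrightarrow>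
      g \<in> lat_pos_space M D w"
  shows "f \<in> lat_space M D w"
proof -
  have part: "(\<lambda>x. max 0 (s * f x)) \<in> lat_pos_space M D w" for s
    using f by (intro pos[of _ s]) (auto simp: L1_funs_def fun_on_def)
  have "f = (\<lambda>x. max 0 (1 * f x) - max 0 (-1 * f x))"
    by (auto simp: max_def)
  then show ?thesis
    unfolding lat_space_def mem_Collect_eq using part[of 1] part[of "-1"] by (intro exI conjI)
qed

lemma vert_spaceI:
  fixes \<sigma> \<tau> :: "nat \<Rightarrow> 'a \<Rightarrow> real"
  assumes f: "f \<in> fun_on X" and D: "\<And>m. \<sigma> m \<in> D" "\<And>m. \<tau> m \<in> D"
    and le: "\<And>m x. \<sigma> m x \<le> f x" "\<And>m x. f x \<le> \<tau> m x"
    and w: "\<And>m. w (\<sigma> m) \<le> c" "\<And>m. c \<le> w (\<tau> m)"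
    and lim: "(\<lambda>m. w (\<sigma> m)) \<longlonglongrightarrow> c" "(\<lambda>m. w (\<tau> m)) \<longlonglongrightarrow> c"
  shows "f \<in> vert_space X D w"
proof -
  have "Sup (w ` range \<sigma>) = c"
    using w lim by (intro cSup_eq) (auto intro: LIMSEQ_le_const2)
  moreover have "Inf (w ` range \<tau>) = c"
    using w lim by (intro cInf_eq) (auto intro: LIMSEQ_le_const)
  moreover have "bdd_above (w ` range \<sigma>)" "bdd_below (w ` range \<tau>)"
    using w by (auto intro!: bdd_aboveI bdd_belowI)
  ultimately have "vert_witness D w f (range \<sigma>) (range \<tau>)"
    using D le by (auto simp: vert_witness_def le_fun_def)
  then show ?thesis
    using f by (auto simp: vert_space_def)
qed

section \<open>Bracketing on a grid\<close>

text \<open>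
  The largest multiple of \<open>p x / (m + 1)\<close> that is at most \<open>f x\<close>.  Where \<open>p x = 0\<close> the value is zero,
  which is correct because \<open>f\<close> is required to vanish there.
\<close>

definition grid_below :: "('a \<Rightarrow> real) \<Rightarrow> ('a \<Rightarrow> real) \<Rightarrow> nat \<Rightarrow> 'a \<Rightarrow> real" where
  "grid_below p f m x = p x / real (Suc m) * of_int \<lfloor>real (Suc m) * f x / p x\<rfloor>"

definition grid_above :: "('a \<Rightarrow> real) \<Rightarrow> ('a \<Rightarrow> real) \<Rightarrow> nat \<Rightarrow> 'a \<Rightarrow> real" where
  "grid_above p f m x = grid_below p f m x + p x / real (Suc m)"

lemma grid_bounds:
  assumes "0 \<le> p x" "p x = 0 \<Longrightarrow> f x = 0"
  shows "grid_below p f m x \<le> f x" "f x \<le> grid_above p f m x"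
proof -
  have "grid_below p f m x \<le> f x \<and> f x \<le> grid_above p f m x"
  proof (cases "p x = 0")
    case True
    then show ?thesis
      using assms by (simp add: grid_below_def grid_above_def)
  next
    case False
    define q where "q = p x / real (Suc m)"
    have q: "q > 0"
      using False assms by (simp add: q_def)
    define k where "k = real_of_int \<lfloor>f x / q\<rfloor>"
    have k: "k \<le> f x / q" "f x / q \<le> k + 1"
      unfolding k_def by linarith+
    have "real (Suc m) * f x / p x = f x / q"
      by (simp add: q_def)
    then have "grid_below p f m x = q * k" "grid_above p f m x = q * (k + 1)"
      by (simp_all add: grid_below_def grid_above_def q_def k_def algebra_simps)
    then show ?thesis
      using k q by (simp add: field_simps)
  qed
  then show "grid_below p f m x \<le> f x" "f x \<le> grid_above p f m x"
    by auto
qed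

text \<open>
  Both bounds differ from \<open>f\<close> by at most \<open>p / (m + 1)\<close>, so \<open>\<bar>f\<bar> + p / (m + 1)\<close> dominates the lower one.
\<close>

lemma grid_L1:
  assumes f: "f \<in> L1_funs M" and p: "p \<in> L1_funs M" "\<And>x. 0 \<le> p x" and z: "\<And>x. p x = 0 \<Longrightarrow> f x = 0"
  shows "grid_below p f m \<in> L1_funs M" "grid_above p f m \<in> L1_funs M"
proof -
  have fi: "integrable M f" and pi: "integrable M p"
    using f p by (auto simp: L1_funs_def)
  then have [measurable]: "f \<in> borel_measurable M" "p \<in> borel_measurable M"
    by auto
  have int: "integrable M (grid_below p f m)"
  proof (rule Bochner_Integration.integrable_bound)
    show "integrable M (\<lambda>x. \<bar>f x\<bar> + p x / real (Suc m))"
      using fi pi by auto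
    show "grid_below p f m \<in> borel_measurable M"
      unfolding grid_below_def[abs_def] by measurable
    have "\<bar>grid_below p f m x\<bar> \<le> \<bar>f x\<bar> + p x / real (Suc m)" for x
      using grid_bounds[of p x f m, OF p(2) z] unfolding grid_above_def by linarith
    then show "AE x in M. norm (grid_below p f m x) \<le> norm (\<bar>f x\<bar> + p x / real (Suc m))"
      using p(2) by simp
  qed
  show "grid_below p f m \<in> L1_funs M"
    using int p by (simp add: L1_funs_def fun_on_def grid_below_def)
  show "grid_above p f m \<in> L1_funs M"
    using Bochner_Integration.integrable_add[OF int integrable_divide[OF pi, of "real (Suc m)"]] p(1)
    by (auto simp: L1_funs_def fun_on_def grid_above_def[abs_def] grid_below_def)
qed

text \<open>
  The gap between the two bounds is exactly \<open>p / (m + 1)\<close>, so their integrals enclose \<open>\<integral>f\<close> within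
  \<open>(\<integral>p) / (m + 1)\<close>.
\<close>

lemma vert_space_gridI:
  assumes D: "integral_on M D w"
    and f: "f \<in> L1_funs M" and p: "p \<in> L1_funs M" "\<And>x. 0 \<le> p x" and z: "\<And>x. p x = 0 \<Longrightarrow> f x = 0"
    and in_D: "\<And>m. grid_below p f m \<in> D" "\<And>m. grid_above p f m \<in> D"
  shows "f \<in> vert_space (space M) D w"
proof -
  let ?c = "LINT x|M. f x" and ?e = "\<lambda>m. (LINT x|M. p x) / real (Suc m)"
  have fi: "integrable M f" and pi: "integrable M p"
    using f p by (auto simp: L1_funs_def)
  have b: "grid_below p f m x \<le> f x" "f x \<le> grid_above p f m x" for m x
    using grid_bounds[of p x f m, OF p(2) z] by auto
  have si: "integrable M (grid_below p f m)" and ti: "integrable M (grid_above p f m)"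
    and w: "w (grid_below p f m) = (LINT x|M. grid_below p f m x)"
      "w (grid_above p f m) = (LINT x|M. grid_above p f m x)" for m
    using integral_onD[OF D] in_D by auto
  have lower: "w (grid_below p f m) \<le> ?c" and upper: "?c \<le> w (grid_above p f m)" for m
    unfolding w using si ti fi b by (auto intro!: integral_mono)
  have gap: "w (grid_above p f m) = w (grid_below p f m) + ?e m" for m
    using si[of m] pi unfolding w grid_above_def by simp
  have e: "?e \<longlonglongrightarrow> 0"
    by (rule LIMSEQ_Suc[OF lim_const_over_n])
  have lim: "(\<lambda>m. w (grid_below p f m)) \<longlonglongrightarrow> ?c"
  proof (rule tendsto_sandwich)
    show "(\<lambda>m. ?c - ?e m) \<longlonglongrightarrow> ?c"
      using tendsto_diff[OF tendsto_const e] by simp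
    show "\<forall>\<^sub>F m in sequentially. ?c - ?e m \<le> w (grid_below p f m)"
      using upper gap by (intro always_eventually) (simp add: algebra_simps)
  qed (use lower in auto)
  have "(\<lambda>m. w (grid_above p f m)) \<longlonglongrightarrow> ?c"
    unfolding gap using tendsto_add[OF lim e] by simp
  then show ?thesis
    using lim f in_D b lower upper
    by (intro vert_spaceI[where \<sigma> = "grid_below p f" and \<tau> = "grid_above p f" and c = ?c])
      (auto simp: L1_funs_def)
qed

section \<open>Integrable functions lie in both iterated extensions\<close>

text \<open>
  With the indicator of \<open>A\<close> as weight, the grid has constant mesh on \<open>A\<close>, and a bounded function meets
  only finitely many grid points, so both grid bounds are simple.
\<close>

lemma bounded_in_S_V:
  assumes f: "f \<in> borel_measurable M" and A: "A \<in> fin_sets M"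
    and off: "\<And>x. x \<notin> A \<Longrightarrow> f x = 0" and bd: "\<And>x. \<bar>f x\<bar> \<le> K"
  shows "f \<in> S_V M"
  unfolding S_V_def
proof (rule vert_space_gridI[OF integral_on_simple, where p = "indicat_real A"])
  note A' = fin_setsD[OF A]
  have [measurable]: "A \<in> sets M" "f \<in> borel_measurable M"
    by fact+
  show p: "indicat_real A \<in> L1_funs M"
    using A' by (auto simp: L1_funs_def fun_on_def indicator_def integrable_real_indicator)
  have "integrable M f"
  proof (rule Bochner_Integration.integrable_bound)
    show "integrable M (\<lambda>x. K * indicat_real A x)"
      using A' by (intro integrable_mult_right integrable_real_indicator)
    show "AE x in M. norm (f x) \<le> norm (K * indicat_real A x)"
      using off order_trans[OF bd abs_ge_self] by (intro AE_I2) (auto simp: indicator_def)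
  qed fact
  then show "f \<in> L1_funs M"
    using off A' by (auto simp: L1_funs_def fun_on_def)
  show "f x = 0" if "indicat_real A x = 0" for x
    using off that by (auto simp: indicator_def split: if_splits)
  fix m
  let ?s = "grid_below (indicat_real A) f m" and ?t = "grid_above (indicat_real A) f m"
  have s: "?s \<in> borel_measurable M"
    unfolding grid_below_def[abs_def] by measurable
  have t: "?t \<in> borel_measurable M"
    using s unfolding grid_above_def[abs_def] by measurable
  \<comment> \<open>\<open>Z\<close> contains every integer that can occur as the floor of \<open>(m + 1) f x\<close>.\<close>
  define Z where "Z = {-\<lceil>real (Suc m) * K\<rceil> - 1..\<lceil>real (Suc m) * K\<rceil>}"
  define R where "R = (\<lambda>k. real_of_int k / real (Suc m)) ` Z"
  have val: "?s x \<in> insert 0 R" for x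
  proof (cases "x \<in> A")
    case True
    have "\<bar>real (Suc m) * f x\<bar> \<le> real (Suc m) * K"
      unfolding abs_mult using bd[of x] by (auto intro!: mult_mono)
    then have "\<lfloor>real (Suc m) * f x\<rfloor> \<in> Z"
      unfolding Z_def by (simp only: atLeastAtMost_iff) linarith
    then show ?thesis
      using True by (auto simp: grid_below_def R_def)
  qed (simp add: grid_below_def)
  have finR: "finite (insert 0 R)"
    by (simp add: R_def Z_def)
  have "finite (range ?s)"
    using val by (intro finite_subset[OF _ finR]) auto
  then show "?s \<in> simple_funs M"
    using s A by (intro simple_funsI[where A = A]) (auto simp: grid_below_def)
  define T where "T = (\<lambda>(a, b). a + b) ` (insert 0 R \<times> {0, 1 / real (Suc m)})"
  have finT: "finite T"
    unfolding T_def using finR by (intro finite_imageI finite_cartesian_product) auto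
  have "?t x \<in> T" for x
    using val[of x] unfolding grid_above_def T_def by (cases "x \<in> A") (auto simp: image_iff)
  then have "finite (range ?t)"
    by (intro finite_subset[OF _ finT]) (rule image_subsetI)
  then show "?t \<in> simple_funs M"
    using t A by (intro simple_funsI[where A = A]) (auto simp: grid_below_def grid_above_def)
qed simp

text \<open>
  Labelling points by the integer part of \<open>g\<close> makes \<open>g\<close> bounded on each piece, so that
  each piece falls under the bounded case.
\<close>

lemma L1_subset_S_VL:
  assumes "complete_measure M" "sigma_finite_measure M"
  shows "L1_funs M \<subseteq> S_VL M"
proof
  fix f assume f: "f \<in> L1_funs M"
  show "f \<in> S_VL M"
    unfolding S_VL_def
  proof (rule L1_in_lat_spaceI[OF f])
    fix g assume g: "g \<in> L1_funs M" "\<And>x. 0 \<le> g x"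
    have [measurable]: "g \<in> borel_measurable M"
      using g by (auto simp: L1_funs_def)
    have "integral_on M (S_V M) (phi_V M)"
      unfolding S_V_def phi_V_def using assms(1) integral_on_simple by (rule integral_on_vert)
    then show "g \<in> lat_pos_space M (S_V M) (phi_V M)"
    proof (rule lat_pos_spaceI[OF assms(2) _ g, where l = "\<lambda>x. nat \<lfloor>g x\<rfloor>"])
      show "{x \<in> space M. nat \<lfloor>g x\<rfloor> = k} \<in> sets M" for k
        by measurable
      fix A k assume A: "A \<in> fin_sets M" and k: "\<And>x. x \<in> A \<Longrightarrow> nat \<lfloor>g x\<rfloor> = k"
      have [measurable]: "A \<in> sets M"
        using fin_setsD(1)[OF A] .
      have "g x \<le> real k + 1" if "x \<in> A" for x
        using k[OF that] g(2)[of x] by linarith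
      then show "(\<lambda>x. g x * indicat_real A x) \<in> S_V M"
        using g(2) A by (intro bounded_in_S_V[where A = A and K = "real k + 1"]) (auto simp: indicator_def)
    qed
  qed
qed

text \<open>
  Labelling points by the value of the function, coded as a natural number, makes the function
  constant on each piece, hence simple there.
\<close>

lemma countable_range_in_S_L:
  assumes "sigma_finite_measure M" and f: "f \<in> L1_funs M" and cnt: "countable (range f)"
  shows "f \<in> S_L M"
  unfolding S_L_def
proof (rule L1_in_lat_spaceI[OF f])
  fix s :: real and g
  assume g_eq: "g = (\<lambda>x. max 0 (s * f x))" and g: "g \<in> L1_funs M" "\<And>x. 0 \<le> g x"
  have gm[measurable]: "g \<in> borel_measurable M"
    using g by (auto simp: L1_funs_def)
  have cg: "countable (range g)"
    using countable_image[OF cnt, of "\<lambda>v. max 0 (s * v)"] by (simp add: g_eq image_image)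
  show "g \<in> lat_pos_space M (simple_funs M) (simple_int M)"
  proof (rule lat_pos_spaceI[OF assms(1) integral_on_simple g, where l = "\<lambda>x. to_nat_on (range g) (g x)"])
    fix k
    have eq: "{x \<in> space M. to_nat_on (range g) (g x) = k} = g -` {v \<in> range g. to_nat_on (range g) v = k} \<inter> space M"
      by auto
    have "{v \<in> range g. to_nat_on (range g) v = k} \<in> sets borel"
      by (rule sets.countable) (auto intro: countable_subset[OF _ cg])
    then show "{x \<in> space M. to_nat_on (range g) (g x) = k} \<in> sets M"
      unfolding eq by (rule measurable_sets[OF gm])
  next
    fix A k assume A: "A \<in> fin_sets M" and k: "\<And>x. x \<in> A \<Longrightarrow> to_nat_on (range g) (g x) = k"
    have [measurable]: "A \<in> sets M"
      using fin_setsD(1)[OF A] .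
    have "g x = from_nat_into (range g) k" if "x \<in> A" for x
      using k[OF that] cg by (metis from_nat_into_to_nat_on rangeI)
    then have "range (\<lambda>x. g x * indicat_real A x) \<subseteq> {0, from_nat_into (range g) k}"
      by (auto simp: indicator_def)
    then have "finite (range (\<lambda>x. g x * indicat_real A x))"
      by (rule finite_subset) simp
    then show "(\<lambda>x. g x * indicat_real A x) \<in> simple_funs M"
      using A by (intro simple_funsI[where A = A]) auto
  qed
qed

text \<open>
  Sigma-finiteness provides an everywhere positive integrable function; rounding its values down to
  integer powers of two keeps it positive and dominated, and leaves only countably many values.
  The result is cut off outside the space because members of \<open>\<L>\<^sup>1(\<mu>)\<close> vanish there.
\<close>

lemma countable_range_weight:
  assumes "sigma_finite_measure M"
  obtains p where "p \<in> L1_funs M" "\<And>x. 0 \<le> p x" "\<And>x. x \<in> space M \<Longrightarrow> p x \<noteq> 0" "countable (range p)"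
proof -
  interpret sigma_finite_measure M by fact
  obtain q :: "'a \<Rightarrow> real" where q[measurable]: "q \<in> borel_measurable M"
    and pos: "\<And>x. 0 < q x" and qi: "integrable M q"
    using obtain_positive_integrable_function by metis
  define p where "p x = (2 powr of_int \<lfloor>log 2 (q x)\<rfloor>) * indicat_real (space M) x" for x
  have pq: "p x \<le> q x" for x
  proof -
    have "2 powr of_int \<lfloor>log 2 (q x)\<rfloor> \<le> 2 powr log 2 (q x)"
      by (intro powr_mono) auto
    then show ?thesis
      using pos[of x] by (auto simp: p_def indicator_def)
  qed
  have p0: "0 \<le> p x" for x
    by (simp add: p_def)
  have "integrable M p"
  proof (rule Bochner_Integration.integrable_bound[OF qi])
    show "p \<in> borel_measurable M"
      unfolding p_def[abs_def] by measurable
    show "AE x in M. norm (p x) \<le> norm (q x)"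
      using pq p0 pos by (intro AE_I2) (simp add: less_imp_le)
  qed
  then have "p \<in> L1_funs M"
    by (simp add: L1_funs_def fun_on_def p_def)
  moreover have "range p \<subseteq> insert 0 (range (\<lambda>k::int. 2 powr of_int k))"
    by (auto simp: p_def indicator_def)
  then have "countable (range p)"
    by (rule countable_subset) auto
  ultimately show ?thesis
    using that p0 by (auto simp: p_def)
qed

text \<open>
  With a weight of countable range the grid bounds are determined by a value of the weight and an
  integer, so they too have countable range.
\<close>

lemma L1_subset_S_LV:
  assumes sf: "sigma_finite_measure M"
  shows "L1_funs M \<subseteq> S_LV M"
proof
  fix f assume f: "f \<in> L1_funs M"
  obtain p where p: "p \<in> L1_funs M" "\<And>x. 0 \<le> p x" "\<And>x. x \<in> space M \<Longrightarrow> p x \<noteq> 0" and cp: "countable (range p)"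
    using countable_range_weight[OF sf] by blast
  have z: "f x = 0" if "p x = 0" for x
    using p(3)[of x] that f by (auto simp: L1_funs_def fun_on_def)
  show "f \<in> S_LV M"
    unfolding S_LV_def
  proof (rule vert_space_gridI[OF _ f p(1,2) z])
    show "integral_on M (S_L M) (phi_L M)"
      unfolding S_L_def phi_L_def using integral_on_simple by (rule integral_on_lat)
    fix m
    let ?C = "range p \<times> (UNIV :: int set)"
    have C: "countable ?C"
      using cp by (intro countable_SIGMA) auto
    have "range (grid_below p f m) \<subseteq> (\<lambda>(v, k). v / real (Suc m) * of_int k) ` ?C"
      by (auto simp: grid_below_def)
    then have "countable (range (grid_below p f m))"
      using C countable_image countable_subset by blast
    then show "grid_below p f m \<in> S_L M"
      using grid_L1(1)[OF f p(1,2) z] sf by (intro countable_range_in_S_L)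
    have "range (grid_above p f m) \<subseteq> (\<lambda>(v, k). v / real (Suc m) * of_int k + v / real (Suc m)) ` ?C"
      by (auto simp: grid_above_def grid_below_def)
    then have "countable (range (grid_above p f m))"
      using C countable_image countable_subset by blast
    then show "grid_above p f m \<in> S_L M"
      using grid_L1(2)[OF f p(1,2) z] sf by (intro countable_range_in_S_L)
  qed
qed

section \<open>The extension of the integral on simple functions\<close>

theorem theorem7p1:
  fixes M :: "'a measure"
  assumes "complete_measure M" and "sigma_finite_measure M"
  shows "S_VL M = S_LV M \<and> (\<forall>f\<in>S_VL M. phi_VL M f = phi_LV M f) \<and>
         S_VL M = L1_funs M \<and> (\<forall>f\<in>S_VL M. phi_VL M f = (LINT x|M. f x))"
proof -
  have VL: "integral_on M (S_VL M) (phi_VL M)"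
    unfolding S_VL_def phi_VL_def S_V_def phi_V_def
    by (intro integral_on_lat integral_on_vert integral_on_simple assms)
  have LV: "integral_on M (S_LV M) (phi_LV M)"
    unfolding S_LV_def phi_LV_def S_L_def phi_L_def
    by (intro integral_on_vert integral_on_lat integral_on_simple assms)
  have "S_VL M = L1_funs M" "S_LV M = L1_funs M"
    using VL LV L1_subset_S_VL[OF assms] L1_subset_S_LV[OF assms(2)]
    by (auto simp: integral_on_def)
  then show ?thesis
    using VL LV by (simp add: integral_on_def)
qed

end
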